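(* Let $E$ be a quasi-Banach ideal space with the Fatou property over the counting measure space $(\mathbb N,2^{\mathbb N},m)$ such that $l_\infty\not\subset E$, and let $\varphi$ be an Orlicz function with $a_\varphi<b_\varphi$ and $\alpha^E_\varphi>0$. (i) If $a_\varphi>0$, then $E_\varphi$ contains an order linearly isometric copy of $l_\infty$. (ii) Assume that $a_\varphi=0$ and there exist a number $d>0$ and an increasing sequence of natural numbers $(i_j)_{j=1}^\infty$ such that $\|e(i_j)\|_E\le d$ for any $j\in\mathbb N$ and $\sum_{j=1}^\infty e(i_j)\notin E$, where $e(i)$ is the $i$-th unit vector. If $\varphi\notin\Delta_2(0)$, then $E_\varphi$ contains an order linearly isometric copy of $l_\infty$.
   Context: $L^0$ is the space of all real sequences, with the coordinatewise order; $\sum_j e(i_j)$ denotes the characteristic sequence of $\{i_j\}$. A quasi-norm is a functional satisfying the axioms of a norm with the triangle inequality replaced by $\|x+y\|\le C(\|x\|+\|y\|)$ for some constant $C\ge1$. A quasi-Banach ideal space over $\mathbb N$ is a linear subspace $E\subset L^0$ with a complete quasi-norm $\|\cdot\|_E$ such that (i) $x\in L^0$, $y\in E$, $|x|\le|y|$ imply $x\in E$, $\|x\|_E\le\|y\|_E$; (ii) some $x\in E$ has all coordinates strictly positive. $E$ has the Fatou property if $0\le x_n\uparrow|x|$ coordinatewise, $x_n\in E$, $x\in L^0$, $\sup_n\|x_n\|_E<\infty$ imply $x\in E$ and $\|x_n\|_E\to\|x\|_E$. An Orlicz function is a non-decreasing $\varphi:[0,\infty)\to[0,\infty]$ with $\varphi(0)=0$,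 right continuous at $0$, continuous on $(0,b_\varphi)$ and left continuous at $b_\varphi$, where $b_\varphi=\sup\{u\ge0:\varphi(u)<\infty\}$, and with $\lim_{u\to\infty}\varphi(u)=\infty$. $a_\varphi=\sup\{u\ge0:\varphi(u)=0\}$. $\varphi\in\Delta_2(0)$ means: there are $K,u_0\in(0,\infty)$ with $\varphi(u_0)>0$ and $\varphi(2u)\le K\varphi(u)$ for all $0\le u\le u_0$. Indices: $\alpha^a_\varphi$ is the supremum of $p\in\mathbb R$ for which there is $K\ge1$ with $\varphi(au)\le Ka^p\varphi(u)$ for all $u\ge0$, $0<a\le1$; $\alpha^0_\varphi$ is the same with the inequality required only for $0\le u\le u_0$, for some $u_0>0$. Here (as $l_\infty\not\subset E$) $\alpha^E_\varphi=\alpha^a_\varphi$ if $E\not\subset l_\infty$, and $\alpha^E_\varphi=\alpha^0_\varphi$ if $E\subset l_\infty$. $\rho^E_\varphi(x)=\|\varphi(|x|)\|_E$ if $\varphi(|x|)\in E$, and $=\infty$ otherwise; $E_\varphi=\{x\in L^0:\rho^E_\varphi(\lambda x)<\infty\text{ for some }\lambda>0\}$ with the quasi-norm $\|x\|_\varphi=\inf\{\lambda>0:\rho^E_\varphi(x/\lambda)\le1\}$. A quasi-normed ideal space $F$ contains an order linearly isometric copy of $l_\infty$ if there is a linear map $P:l_\infty\to F$ with $\|Pz\|_F=\|z\|_{l_\infty}$ and $|Pz|=P|z|$ for all $z\in l_\infty$ (in particular $Pz\ge0$ when $z\ge0$). *)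

theory Defs
  imports "HOL-Analysis.Analysis"
begin

text \<open>
  \<open>L\<^sup>0\<close> is the type \<^typ>\<open>nat \<Rightarrow> real\<close>. A space of sequences is given by its carrier
  \<open>E\<close> together with a functional \<open>N\<close> of which only the values on \<open>E\<close> are meaningful.
\<close>

definition seq_subspace :: "(nat \<Rightarrow> real) set \<Rightarrow> bool" where
  "seq_subspace E \<longleftrightarrow>
     (\<lambda>_. 0) \<in> E \<and>
     (\<forall>x\<in>E. \<forall>y\<in>E. (\<lambda>k. x k + y k) \<in> E) \<and>
     (\<forall>c. \<forall>x\<in>E. (\<lambda>k. c * x k) \<in> E)"

definition quasi_norm_on :: "(nat \<Rightarrow> real) set \<Rightarrow> ((nat \<Rightarrow> real) \<Rightarrow> real) \<Rightarrow> bool" where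
  "quasi_norm_on E N \<longleftrightarrow>
     (\<forall>x\<in>E. 0 \<le> N x) \<and>
     (\<forall>x\<in>E. N x = 0 \<longleftrightarrow> x = (\<lambda>_. 0)) \<and>
     (\<forall>c. \<forall>x\<in>E. N (\<lambda>k. c * x k) = \<bar>c\<bar> * N x) \<and>
     (\<exists>C\<ge>1. \<forall>x\<in>E. \<forall>y\<in>E. N (\<lambda>k. x k + y k) \<le> C * (N x + N y))"

definition quasi_norm_complete :: "(nat \<Rightarrow> real) set \<Rightarrow> ((nat \<Rightarrow> real) \<Rightarrow> real) \<Rightarrow> bool" where
  "quasi_norm_complete E N \<longleftrightarrow>
     (\<forall>X :: nat \<Rightarrow> nat \<Rightarrow> real.
        (\<forall>n. X n \<in> E) \<and>
        (\<forall>\<epsilon>>0. \<exists>M. \<forall>m\<ge>M. \<forall>n\<ge>M. N (\<lambda>k. X m k - X n k) < \<epsilon>) \<longrightarrow>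
        (\<exists>x\<in>E. (\<lambda>n. N (\<lambda>k. X n k - x k)) \<longlonglongrightarrow> 0))"

definition quasi_banach_ideal_space ::
    "(nat \<Rightarrow> real) set \<Rightarrow> ((nat \<Rightarrow> real) \<Rightarrow> real) \<Rightarrow> bool" where
  "quasi_banach_ideal_space E N \<longleftrightarrow>
     seq_subspace E \<and> quasi_norm_on E N \<and> quasi_norm_complete E N \<and>
     (\<forall>x. \<forall>y\<in>E. (\<forall>k. \<bar>x k\<bar> \<le> \<bar>y k\<bar>) \<longrightarrow> x \<in> E \<and> N x \<le> N y) \<and>
     (\<exists>x\<in>E. \<forall>k. 0 < x k)"

definition fatou_property :: "(nat \<Rightarrow> real) set \<Rightarrow> ((nat \<Rightarrow> real) \<Rightarrow> real) \<Rightarrow> bool" where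
  "fatou_property E N \<longleftrightarrow>
     (\<forall>(X :: nat \<Rightarrow> nat \<Rightarrow> real) x.
        (\<forall>n. X n \<in> E) \<and>
        (\<forall>n k. 0 \<le> X n k) \<and> (\<forall>k. incseq (\<lambda>n. X n k)) \<and>
        (\<forall>k. (\<lambda>n. X n k) \<longlonglongrightarrow> \<bar>x k\<bar>) \<and>
        bdd_above (range (\<lambda>n. N (X n))) \<longrightarrow>
        x \<in> E \<and> (\<lambda>n. N (X n)) \<longlonglongrightarrow> N x)"

definition l_infty :: "(nat \<Rightarrow> real) set" where
  "l_infty = {z. bounded (range z)}"

definition l_infty_norm :: "(nat \<Rightarrow> real) \<Rightarrow> real" where
  "l_infty_norm z = (SUP k. \<bar>z k\<bar>)"

text \<open>
  Functions \<open>[0,\<infinity>) \<rightarrow> [0,\<infinity>]\<close> are represented by \<^typ>\<open>real \<Rightarrow> ennreal\<close>; no definition below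
  depends on their values at negative arguments.
\<close>

definition a_val :: "(real \<Rightarrow> ennreal) \<Rightarrow> ereal" where
  "a_val \<phi> = Sup {ereal u | u. 0 \<le> u \<and> \<phi> u = 0}"

definition b_val :: "(real \<Rightarrow> ennreal) \<Rightarrow> ereal" where
  "b_val \<phi> = Sup {ereal u | u. 0 \<le> u \<and> \<phi> u < \<infinity>}"

definition orlicz_function :: "(real \<Rightarrow> ennreal) \<Rightarrow> bool" where
  "orlicz_function \<phi> \<longleftrightarrow>
     mono_on {0..} \<phi> \<and> \<phi> 0 = 0 \<and>
     continuous (at 0 within {0..}) \<phi> \<and>
     continuous_on {u. 0 < u \<and> ereal u < b_val \<phi>} \<phi> \<and>
     (\<forall>b\<ge>0. ereal b = b_val \<phi> \<longrightarrow> continuous (at b within {0..b}) \<phi>) \<and>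
     (\<phi> \<longlongrightarrow> \<infinity>) at_top"

definition delta2_zero :: "(real \<Rightarrow> ennreal) \<Rightarrow> bool" where
  "delta2_zero \<phi> \<longleftrightarrow>
     (\<exists>K u0 :: real. 0 < K \<and> 0 < u0 \<and> \<phi> u0 > 0 \<and>
        (\<forall>u. 0 \<le> u \<and> u \<le> u0 \<longrightarrow> \<phi> (2 * u) \<le> ennreal K * \<phi> u))"

definition alpha_all :: "(real \<Rightarrow> ennreal) \<Rightarrow> ereal" where
  "alpha_all \<phi> = Sup {ereal p | p.
     \<exists>K\<ge>1. \<forall>u\<ge>0. \<forall>a. 0 < a \<and> a \<le> 1 \<longrightarrow>
       \<phi> (a * u) \<le> ennreal (K * a powr p) * \<phi> u}"

definition alpha_zero :: "(real \<Rightarrow> ennreal) \<Rightarrow> ereal" where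
  "alpha_zero \<phi> = Sup {ereal p | p.
     \<exists>K\<ge>1. \<exists>u0>0. \<forall>u. 0 \<le> u \<and> u \<le> u0 \<longrightarrow> (\<forall>a. 0 < a \<and> a \<le> 1 \<longrightarrow>
       \<phi> (a * u) \<le> ennreal (K * a powr p) * \<phi> u)}"

text \<open>The index relative to \<open>E\<close>, for spaces that do not contain \<^const>\<open>l_infty\<close>.\<close>

definition alpha_index :: "(nat \<Rightarrow> real) set \<Rightarrow> (real \<Rightarrow> ennreal) \<Rightarrow> ereal" where
  "alpha_index E \<phi> = (if E \<subseteq> l_infty then alpha_zero \<phi> else alpha_all \<phi>)"

text \<open>
  \<open>\<phi>(|x|) \<in> E\<close> includes that \<open>\<phi>(|x|)\<close> is finite in every coordinate; only then does
  \<^const>\<open>enn2real\<close> give its actual value.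
\<close>

definition orlicz_modular ::
    "(nat \<Rightarrow> real) set \<Rightarrow> ((nat \<Rightarrow> real) \<Rightarrow> real) \<Rightarrow> (real \<Rightarrow> ennreal) \<Rightarrow> (nat \<Rightarrow> real) \<Rightarrow> ennreal" where
  "orlicz_modular E N \<phi> x =
     (if (\<forall>k. \<phi> \<bar>x k\<bar> < \<infinity>) \<and> (\<lambda>k. enn2real (\<phi> \<bar>x k\<bar>)) \<in> E
      then ennreal (N (\<lambda>k. enn2real (\<phi> \<bar>x k\<bar>))) else \<infinity>)"

definition orlicz_space ::
    "(nat \<Rightarrow> real) set \<Rightarrow> ((nat \<Rightarrow> real) \<Rightarrow> real) \<Rightarrow> (real \<Rightarrow> ennreal) \<Rightarrow> (nat \<Rightarrow> real) set" where
  "orlicz_space E N \<phi> = {x. \<exists>c>0. orlicz_modular E N \<phi> (\<lambda>k. c * x k) < \<infinity>}"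

text \<open>
  For \<open>x\<close> in the space \<^term>\<open>orlicz_space E N \<phi>\<close> the set below is nonempty as soon as
  \<^term>\<open>alpha_index E \<phi> > 0\<close>, so the real infimum is the intended one.
\<close>

definition luxemburg_norm ::
    "(nat \<Rightarrow> real) set \<Rightarrow> ((nat \<Rightarrow> real) \<Rightarrow> real) \<Rightarrow> (real \<Rightarrow> ennreal) \<Rightarrow> (nat \<Rightarrow> real) \<Rightarrow> real" where
  "luxemburg_norm E N \<phi> x =
     Inf {c. 0 < c \<and> orlicz_modular E N \<phi> (\<lambda>k. x k / c) \<le> 1}"

definition contains_order_isometric_l_infty ::
    "(nat \<Rightarrow> real) set \<Rightarrow> ((nat \<Rightarrow> real) \<Rightarrow> real) \<Rightarrow> bool" where
  "contains_order_isometric_l_infty F NF \<longleftrightarrow>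
     (\<exists>P :: (nat \<Rightarrow> real) \<Rightarrow> (nat \<Rightarrow> real).
        (\<forall>z\<in>l_infty. P z \<in> F) \<and>
        (\<forall>z\<in>l_infty. \<forall>w\<in>l_infty. P (\<lambda>k. z k + w k) = (\<lambda>k. P z k + P w k)) \<and>
        (\<forall>c. \<forall>z\<in>l_infty. P (\<lambda>k. c * z k) = (\<lambda>k. c * P z k)) \<and>
        (\<forall>z\<in>l_infty. NF (P z) = l_infty_norm z) \<and>
        (\<forall>z\<in>l_infty. (\<lambda>k. \<bar>P z k\<bar>) = P (\<lambda>k. \<bar>z k\<bar>)))"

definition unit_seq :: "nat \<Rightarrow> nat \<Rightarrow> real" where
  "unit_seq i = indicator {i}"

end

theory Submission
  imports Defs
begin

text \<open>
  The copy of \<open>l\<^sub>\<infinity>\<close> is spanned by disjointly supported pieces of one nonnegative sequence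
  \<open>x\<close>. Suppose \<open>\<rho>(x) \<le> 1\<close>, and \<open>x\<close> takes the constant value \<open>u\<^sub>m\<close> on the block \<open>B\<^sub>m\<close> for
  pairwise disjoint finite blocks such that, for every \<open>c > 1\<close>,
  \<open>\<phi>(c u\<^sub>m) \<parallel>1\<^bsub>B\<^sub>m\<^esub>\<parallel> > 1\<close> for all large \<open>m\<close>. Arrange the blocks into infinitely many infinite
  groups and let \<open>P z\<close> multiply \<open>x\<close> by \<open>z\<^sub>n\<close> on the blocks of the \<open>n\<close>-th group. Then
  \<open>\<bar>P z\<bar> \<le> \<parallel>z\<parallel>\<^sub>\<infinity> x\<close> bounds the norm of \<open>P z\<close> from above. From below, if \<open>c < \<bar>z\<^sub>n\<bar>\<close>, then
  \<open>P z / c\<close> dominates \<open>(\<bar>z\<^sub>n\<bar> / c) u\<^sub>m\<close> on arbitrarily late blocks \<open>B\<^sub>m\<close> of the \<open>n\<close>-th group,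
  so its modular exceeds 1. This is the lemma \<open>block_criterion\<close>.

  The blocks come from the Fatou property: if \<open>1\<^sub>I \<notin> E\<close>, then the norms of the indicators of
  finite pieces of \<open>I\<close> are unbounded, however far out the pieces start
  (\<open>indicator_tail_unbounded\<close>).

  If \<open>a = a\<^sub>\<phi> > 0\<close>, take \<open>x = a\<close> constant. Left continuity gives \<open>\<phi>(a) = 0\<close>, so \<open>\<rho>(x) = 0\<close>,
  whereas \<open>\<phi>(c a) > 0\<close> for \<open>c > 1\<close>; blocks with \<open>\<parallel>1\<^bsub>B\<^sub>m\<^esub>\<parallel> > m\<close> do the rest.

  If \<open>a\<^sub>\<phi> = 0\<close> and \<open>\<phi>\<close> fails \<open>\<Delta>\<^sub>2(0)\<close>, then it also fails the corresponding condition for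
  every dilation factor \<open>c > 1\<close> in place of 2 (\<open>not_delta2_zero_dilation\<close>). Hence there are
  arbitrarily small \<open>u\<^sub>m\<close> for which the ratio of \<open>\<phi>((1 + 1/(m+1)) u\<^sub>m)\<close> to \<open>\<phi>(u\<^sub>m)\<close> is as large
  as desired. Because the unit vectors of \<open>I\<close> are bounded in norm by \<open>d\<close>, growing a block point
  by point cannot overshoot a target \<open>t \<ge> d\<close> by more than the factor \<open>2C\<close>
  (\<open>indicator_tail_between\<close>). So \<open>\<phi>(u\<^sub>m) \<parallel>1\<^bsub>B\<^sub>m\<^esub>\<parallel>\<close> can be kept comparable to a prescribed
  \<open>\<epsilon>\<^sub>m\<close>. With \<open>\<epsilon>\<^sub>m\<close> decreasing geometrically fast enough, the pieces sum to a sequence of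
  modular at most 1 (\<open>rapidly_decreasing_sum\<close>), while the dilated pieces have modular above 1.
\<close>

section \<open>Quasi-Banach ideal spaces with the Fatou property\<close>

text \<open>
  The constant of the quasi-triangle inequality is a parameter because the sizes of the blocks
  and the rate of decay of their modulars depend on it.
\<close>

locale fatou_ideal_space =
  fixes E :: "(nat \<Rightarrow> real) set" and N :: "(nat \<Rightarrow> real) \<Rightarrow> real" and C :: real
  assumes ideal_space: "quasi_banach_ideal_space E N"
    and fatou: "fatou_property E N"
    and C_ge_1: "1 \<le> C"
    and quasi_triangle: "\<And>x y. x \<in> E \<Longrightarrow> y \<in> E \<Longrightarrow> N (\<lambda>k. x k + y k) \<le> C * (N x + N y)"
begin

lemma zero_mem: "(\<lambda>_. 0) \<in> E"
  and add_mem: "x \<in> E \<Longrightarrow> y \<in> E \<Longrightarrow> (\<lambda>k. x k + y k) \<in> E"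
  and scale_mem: "x \<in> E \<Longrightarrow> (\<lambda>k. c * x k) \<in> E"
  using ideal_space unfolding quasi_banach_ideal_space_def seq_subspace_def by blast+

lemma N_nonneg: "x \<in> E \<Longrightarrow> 0 \<le> N x"
  and N_scale: "x \<in> E \<Longrightarrow> N (\<lambda>k. c * x k) = \<bar>c\<bar> * N x"
  and N_zero: "N (\<lambda>_. 0) = 0"
  using ideal_space zero_mem unfolding quasi_banach_ideal_space_def quasi_norm_on_def by blast+

lemma ideal:
  assumes "y \<in> E" "\<And>k. \<bar>x k\<bar> \<le> \<bar>y k\<bar>"
  shows ideal_mem: "x \<in> E" and ideal_mono: "N x \<le> N y"
  using ideal_space assms unfolding quasi_banach_ideal_space_def by blast+

text \<open>A sequence of finite support lies below a multiple of the strictly positive element of \<open>E\<close>.\<close>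

lemma finite_support_mem:
  assumes fin: "finite {k. x k \<noteq> 0}"
  shows "x \<in> E"
proof -
  obtain w where w: "w \<in> E" "\<And>k. 0 < w k"
    using ideal_space unfolding quasi_banach_ideal_space_def by blast
  define c where "c = (\<Sum>k | x k \<noteq> 0. \<bar>x k\<bar> / w k)"
  have c0: "0 \<le> c" unfolding c_def by (intro sum_nonneg) (simp add: w(2) less_imp_le)
  have "\<bar>x k\<bar> \<le> \<bar>c * w k\<bar>" for k
  proof (cases "x k = 0")
    case False
    have "\<bar>x k\<bar> / w k \<le> c" unfolding c_def
      by (rule member_le_sum) (use False fin w(2) in \<open>auto simp: less_imp_le\<close>)
    then show ?thesis using w(2)[of k] c0 by (simp add: field_simps abs_mult)
  qed simp
  then show ?thesis by (rule ideal_mem[OF scale_mem[OF w(1)]])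
qed

lemma indicator_finite_mem: "finite B \<Longrightarrow> (indicator B :: nat \<Rightarrow> real) \<in> E"
  by (rule finite_support_mem) (simp add: indicator_eq_0_iff)

text \<open>
  If the norms of the pieces beyond \<open>p\<close> stayed bounded, the Fatou property would put the whole
  tail of \<open>1\<^sub>I\<close> into \<open>E\<close>, and adding the finitely many missing points would put \<open>1\<^sub>I\<close> itself
  into \<open>E\<close>.
\<close>

lemma indicator_tail_unbounded:
  assumes notin: "(indicator I :: nat \<Rightarrow> real) \<notin> E"
  shows "\<exists>q\<ge>p. t < N (indicator (I \<inter> {p..<q}))"
proof (rule ccontr)
  assume "\<not> ?thesis"
  then have bnd: "\<And>q. p \<le> q \<Longrightarrow> N (indicator (I \<inter> {p..<q})) \<le> t" by (auto simp: not_less)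
  define X :: "nat \<Rightarrow> nat \<Rightarrow> real" where "X n = indicator (I \<inter> {p..<p+n})" for n
  define x :: "nat \<Rightarrow> real" where "x = indicator (I \<inter> {p..})"
  have "X n \<in> E" for n unfolding X_def by (rule indicator_finite_mem) simp
  moreover have "0 \<le> X n k" for n k by (simp add: X_def)
  moreover have "incseq (\<lambda>n. X n k)" for k
    unfolding X_def by (intro incseq_SucI) (auto simp: indicator_def)
  moreover have "(\<lambda>n. X n k) \<longlonglongrightarrow> \<bar>x k\<bar>" for k
  proof (rule tendsto_eventually)
    show "\<forall>\<^sub>F n in sequentially. X n k = \<bar>x k\<bar>"
      using eventually_gt_at_top[of k] by eventually_elim (auto simp: X_def x_def indicator_def)
  qed
  moreover have "bdd_above (range (\<lambda>n. N (X n)))"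
    by (rule bdd_aboveI[of _ t]) (auto simp: X_def bnd)
  ultimately have "x \<in> E" using fatou unfolding fatou_property_def by blast
  moreover have "(indicator (I \<inter> {..<p}) :: nat \<Rightarrow> real) \<in> E" by (rule indicator_finite_mem) simp
  ultimately have "(\<lambda>k. x k + indicator (I \<inter> {..<p}) k) \<in> E" by (rule add_mem)
  moreover have "(\<lambda>k. x k + indicator (I \<inter> {..<p}) k) = indicator I"
    by (auto simp: x_def indicator_def)
  ultimately show False using notin by simp
qed

text \<open>
  The shortest piece whose norm exceeds \<open>t\<close> becomes a piece of norm at most \<open>t\<close> when its last
  point is removed, so the quasi-triangle inequality bounds its norm from above as well.
\<close>

lemma indicator_tail_between:
  assumes notin: "(indicator I :: nat \<Rightarrow> real) \<notin> E"
    and unit: "\<And>k. k \<in> I \<Longrightarrow> N (unit_seq k) \<le> d" and "0 \<le> d" "0 \<le> t"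
  shows "\<exists>q\<ge>p. t < N (indicator (I \<inter> {p..<q})) \<and> N (indicator (I \<inter> {p..<q})) \<le> C * (t + d)"
proof -
  define Q where "Q q \<longleftrightarrow> p \<le> q \<and> t < N (indicator (I \<inter> {p..<q}))" for q
  define q where "q = (LEAST q. Q q)"
  have ex: "\<exists>q. Q q" using indicator_tail_unbounded[OF notin] unfolding Q_def by blast
  have q: "p \<le> q" "t < N (indicator (I \<inter> {p..<q}))"
    using LeastI_ex[OF ex] by (auto simp: q_def Q_def)
  have "(indicator {} :: nat \<Rightarrow> real) = (\<lambda>_. 0)" by auto
  with q(2) N_zero \<open>0 \<le> t\<close> have "q \<noteq> p" by auto
  with q(1) obtain r where r: "q = Suc r" "p \<le> r" by (cases q) auto
  have le: "N (indicator (I \<inter> {p..<r})) \<le> t"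
  proof -
    have "\<not> Q r" using r by (intro not_less_Least) (simp add: q_def[symmetric])
    then show ?thesis using r by (simp add: Q_def not_less)
  qed
  have "r \<in> I"
  proof (rule ccontr)
    assume "r \<notin> I"
    then have "I \<inter> {p..<q} = I \<inter> {p..<r}" using r by (auto simp: less_Suc_eq)
    with q(2) le show False by simp
  qed
  have "indicator (I \<inter> {p..<q}) = (\<lambda>k. indicator (I \<inter> {p..<r}) k + unit_seq r k :: real)"
    using r \<open>r \<in> I\<close> by (auto simp: unit_seq_def indicator_def fun_eq_iff less_Suc_eq)
  then have "N (indicator (I \<inter> {p..<q})) \<le> C * (N (indicator (I \<inter> {p..<r})) + N (unit_seq r))"
    using quasi_triangle[of "indicator (I \<inter> {p..<r})" "unit_seq r"]
    by (simp add: indicator_finite_mem unit_seq_def)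
  also have "\<dots> \<le> C * (t + d)"
    using le unit[OF \<open>r \<in> I\<close>] C_ge_1 by (intro mult_left_mono) auto
  finally show ?thesis using q by blast
qed

text \<open>
  Splitting off the first summand repeatedly costs one more factor \<open>C\<close> at each step, so the
  later a summand comes, the smaller it has to be.
\<close>

lemma partial_sum_bound:
  assumes "\<And>m. y m \<in> E"
  shows "(\<lambda>k. \<Sum>m<n. y m k) \<in> E \<and> N (\<lambda>k. \<Sum>m<n. y m k) \<le> (\<Sum>m<n. C ^ Suc m * N (y m))"
  using assms
proof (induction n arbitrary: y)
  case 0
  then show ?case by (simp add: zero_mem N_zero)
next
  case (Suc n)
  let ?S = "\<lambda>k. \<Sum>m<n. y (Suc m) k"
  have IH: "?S \<in> E" "N ?S \<le> (\<Sum>m<n. C ^ Suc m * N (y (Suc m)))"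
    using Suc.IH[of "\<lambda>m. y (Suc m)"] Suc.prems by auto
  have eq: "(\<lambda>k. \<Sum>m<Suc n. y m k) = (\<lambda>k. y 0 k + ?S k)"
    by (simp only: sum.lessThan_Suc_shift)
  have "N (\<lambda>k. y 0 k + ?S k) \<le> C * (N (y 0) + N ?S)"
    by (rule quasi_triangle) (use IH Suc.prems in auto)
  also have "\<dots> \<le> C * (N (y 0) + (\<Sum>m<n. C ^ Suc m * N (y (Suc m))))"
    using IH C_ge_1 by (intro mult_left_mono) auto
  also have "\<dots> = (\<Sum>m<Suc n. C ^ Suc m * N (y m))"
    by (subst sum.lessThan_Suc_shift) (simp add: distrib_left sum_distrib_left mult.assoc)
  finally show ?case using eq add_mem[OF Suc.prems[of 0] IH(1)] by simp
qed

text \<open>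
  The decay \<open>(2C)\<^bsup>-(m+1)\<^esup>\<close> cancels the factors \<open>C\<^bsup>m+1\<^esup>\<close> of the previous bound and leaves a
  geometric series of sum 1; the Fatou property carries the bound over from the partial sums
  to the limit.
\<close>

lemma rapidly_decreasing_sum:
  assumes "\<And>m. y m \<in> E" and nonneg: "\<And>m k. 0 \<le> y m k"
    and small: "\<And>m. N (y m) \<le> (1 / (2 * C)) ^ Suc m"
    and lim: "\<And>k. (\<lambda>m. y m k) sums s k"
  shows "s \<in> E" "N s \<le> 1"
proof -
  define X where "X n k = (\<Sum>m<n. y m k)" for n k
  have XE: "X n \<in> E" for n
    using partial_sum_bound[OF assms(1), where n=n] by (simp add: X_def[abs_def])
  have X1: "N (X n) \<le> 1" for n
  proof -
    have "N (X n) \<le> (\<Sum>m<n. C ^ Suc m * N (y m))"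
      using partial_sum_bound[OF assms(1), where n=n] by (simp add: X_def[abs_def])
    also have "\<dots> \<le> (\<Sum>m<n. (1/2) ^ Suc m)"
    proof (rule sum_mono)
      fix m
      have "C ^ Suc m * N (y m) \<le> C ^ Suc m * (1 / (2 * C)) ^ Suc m"
        using small[of m] C_ge_1 by (intro mult_left_mono) auto
      also have "\<dots> = (1/2) ^ Suc m"
        using C_ge_1 by (subst power_mult_distrib[symmetric]) simp
      finally show "C ^ Suc m * N (y m) \<le> (1/2) ^ Suc m" .
    qed
    also have "\<dots> = 1 - (1/2::real) ^ n" by (induction n) auto
    also have "\<dots> \<le> 1" by simp
    finally show ?thesis .
  qed
  have "incseq (\<lambda>n. X n k)" for k
    unfolding X_def by (intro incseq_SucI) (simp add: nonneg)
  moreover have "0 \<le> X n k" for n k unfolding X_def by (intro sum_nonneg nonneg)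
  moreover have "(\<lambda>n. X n k) \<longlonglongrightarrow> \<bar>s k\<bar>" for k
  proof -
    have "0 \<le> s k" by (rule sums_le[OF nonneg sums_zero lim])
    with lim show ?thesis by (simp add: sums_def X_def)
  qed
  moreover have "bdd_above (range (\<lambda>n. N (X n)))"
    by (rule bdd_aboveI[of _ 1]) (auto simp: X1)
  ultimately have "s \<in> E \<and> (\<lambda>n. N (X n)) \<longlonglongrightarrow> N s"
    using fatou XE unfolding fatou_property_def by blast
  then show "s \<in> E" "N s \<le> 1" by (auto intro: LIMSEQ_le_const2 simp: X1)
qed

section \<open>A criterion for copies of the bounded sequences\<close>

lemma orlicz_modular_mono:
  assumes "mono_on {0..} \<phi>" and le: "\<And>k. \<bar>x k\<bar> \<le> \<bar>y k\<bar>"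
  shows "orlicz_modular E N \<phi> x \<le> orlicz_modular E N \<phi> y"
proof (cases "(\<forall>k. \<phi> \<bar>y k\<bar> < \<infinity>) \<and> (\<lambda>k. enn2real (\<phi> \<bar>y k\<bar>)) \<in> E")
  case True
  have phi: "\<phi> \<bar>x k\<bar> \<le> \<phi> \<bar>y k\<bar>" for k
    using assms by (intro mono_onD[OF assms(1)]) auto
  have fin: "\<phi> \<bar>x k\<bar> < \<infinity>" for k using phi True by (metis order_le_less_trans)
  have "\<bar>enn2real (\<phi> \<bar>x k\<bar>)\<bar> \<le> \<bar>enn2real (\<phi> \<bar>y k\<bar>)\<bar>" for k
    using phi True by (auto intro!: enn2real_mono)
  with True have "(\<lambda>k. enn2real (\<phi> \<bar>x k\<bar>)) \<in> E"
    "N (\<lambda>k. enn2real (\<phi> \<bar>x k\<bar>)) \<le> N (\<lambda>k. enn2real (\<phi> \<bar>y k\<bar>))"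
    using ideal[of "\<lambda>k. enn2real (\<phi> \<bar>y k\<bar>)" "\<lambda>k. enn2real (\<phi> \<bar>x k\<bar>)"] by auto
  with True fin show ?thesis by (simp add: orlicz_modular_def ennreal_leI)
qed (auto simp: orlicz_modular_def)

text \<open>
  The hypothesis on the product covers the case \<open>\<phi> v = \<infinity>\<close> too: then \<open>B\<close> cannot be empty, since
  the product would vanish, and the modular is infinite.
\<close>

lemma orlicz_modular_step:
  assumes "\<phi> 0 = 0" "0 \<le> v" "finite B" "1 < \<phi> v * ennreal (N (indicator B))"
  shows "1 < orlicz_modular E N \<phi> (\<lambda>k. v * indicator B k)"
proof (cases "\<phi> v = \<infinity>")
  case True
  have "B \<noteq> {}"
  proof
    assume "B = {}"
    then have "indicator B = (\<lambda>_::nat. 0::real)" by auto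
    with assms(4) N_zero show False by simp
  qed
  then obtain k where "k \<in> B" by blast
  then have "\<phi> \<bar>v * indicator B k\<bar> = \<infinity>" using True assms(2) by simp
  then have "orlicz_modular E N \<phi> (\<lambda>k. v * indicator B k) = \<infinity>"
    unfolding orlicz_modular_def by (metis less_irrefl)
  then show ?thesis by simp
next
  case False
  define r where "r = enn2real (\<phi> v)"
  have r: "\<phi> v = ennreal r" "0 \<le> r" using False by (auto simp: r_def less_top)
  have val: "\<phi> \<bar>v * indicator B k\<bar> = ennreal (r * indicator B k)" for k
    using assms(1,2) r by (auto simp: indicator_def)
  have ind: "indicator B \<in> E" using assms(3) by (rule indicator_finite_mem)
  have "orlicz_modular E N \<phi> (\<lambda>k. v * indicator B k) = ennreal (r * N (indicator B))"
    unfolding orlicz_modular_def val using r ind by (simp add: scale_mem N_scale)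
  also have "\<dots> = \<phi> v * ennreal (N (indicator B))"
    using r N_nonneg[OF ind] by (simp add: ennreal_mult)
  finally show ?thesis using assms(4) by simp
qed

text \<open>
  The blocks are indexed by pairs through the bijection \<^const>\<open>prod_decode\<close>. The first
  component is the coordinate of \<open>z\<close> that a block carries, and the second one makes each group
  infinite, so that every coordinate of \<open>z\<close> is seen on blocks with arbitrarily large index.
\<close>

proposition block_criterion:
  assumes mono: "mono_on {0..} \<phi>" and phi0: "\<phi> 0 = 0"
    and x0: "\<And>k. 0 \<le> x k" and rho: "orlicz_modular E N \<phi> x \<le> 1"
    and disj: "disjoint_family B" and finB: "\<And>m. finite (B m)"
    and xB: "\<And>m k. k \<in> B m \<Longrightarrow> x k = u m" and u0: "\<And>m. 0 \<le> u m"
    and large: "\<And>c. 1 < c \<Longrightarrow> \<forall>\<^sub>F m in sequentially. 1 < \<phi> (c * u m) * ennreal (N (indicator (B m)))"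
  shows "contains_order_isometric_l_infty (orlicz_space E N \<phi>) (luxemburg_norm E N \<phi>)"
proof -
  \<comment> \<open>Off the blocks the value of \<open>f\<close> is arbitrary, which is harmless: there only \<open>\<bar>P z\<bar> \<le> \<parallel>z\<parallel>\<^sub>\<infinity> x\<close> matters.\<close>
  define f where "f k = fst (prod_decode (SOME m. k \<in> B m))" for k
  define P :: "(nat \<Rightarrow> real) \<Rightarrow> nat \<Rightarrow> real" where "P z k = z (f k) * x k" for z k
  have f: "f k = fst (prod_decode m)" if "k \<in> B m" for k m
  proof -
    have "k \<in> B (SOME m. k \<in> B m)" using that by (rule someI)
    with that disj have "(SOME m. k \<in> B m) = m" unfolding disjoint_family_on_def by blast
    then show ?thesis by (simp add: f_def)
  qed
  have bdd: "bdd_above (range (\<lambda>n. \<bar>z n\<bar>))" if z: "z \<in> l_infty" for z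
  proof -
    obtain b where "\<forall>r\<in>range z. norm r \<le> b" using z by (auto simp: l_infty_def bounded_iff)
    then show ?thesis by (intro bdd_aboveI[of _ b]) auto
  qed
  have z_le: "\<bar>z n\<bar> \<le> l_infty_norm z" if "z \<in> l_infty" for z n
    unfolding l_infty_norm_def by (rule cSUP_upper[OF UNIV_I bdd[OF that]])
  have upper: "orlicz_modular E N \<phi> (\<lambda>k. P z k / c) \<le> 1"
    if z: "z \<in> l_infty" and c: "0 < c" "l_infty_norm z \<le> c" for z c
  proof -
    have "\<bar>P z k / c\<bar> \<le> \<bar>x k\<bar>" for k
    proof -
      have "\<bar>z (f k)\<bar> * x k \<le> c * x k"
        using z_le[OF z, of "f k"] c x0[of k] by (intro mult_right_mono) auto
      then show ?thesis using c x0[of k] by (simp add: P_def abs_mult field_simps)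
    qed
    then show ?thesis by (rule order_trans[OF orlicz_modular_mono[OF mono] rho])
  qed
  have lower: "\<bar>z n\<bar> \<le> c" if c: "0 < c" "orlicz_modular E N \<phi> (\<lambda>k. P z k / c) \<le> 1" for z n c
  proof (rule ccontr)
    assume "\<not> \<bar>z n\<bar> \<le> c"
    then have l: "1 < \<bar>z n\<bar> / c" using c by simp
    from large[OF l] obtain j where
      j: "\<And>m. j \<le> m \<Longrightarrow> 1 < \<phi> (\<bar>z n\<bar> / c * u m) * ennreal (N (indicator (B m)))"
      unfolding eventually_sequentially by blast
    \<comment> \<open>A block of the \<open>n\<close>-th group whose index is at least \<open>j\<close>.\<close>
    define m where "m = prod_encode (n, j)"
    have "1 < orlicz_modular E N \<phi> (\<lambda>k. (\<bar>z n\<bar> / c * u m) * indicator (B m) k)"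
      by (rule orlicz_modular_step)
        (use c u0 phi0 finB j[of m] le_prod_encode_2[of j n] in \<open>auto simp: m_def\<close>)
    also have "\<dots> \<le> orlicz_modular E N \<phi> (\<lambda>k. P z k / c)"
    proof (rule orlicz_modular_mono[OF mono])
      fix k
      show "\<bar>\<bar>z n\<bar> / c * u m * indicator (B m) k\<bar> \<le> \<bar>P z k / c\<bar>"
        by (cases "k \<in> B m") (simp_all add: P_def f xB m_def abs_mult)
    qed
    finally show False using c(2) by simp
  qed
  have norm: "luxemburg_norm E N \<phi> (P z) = l_infty_norm z" if z: "z \<in> l_infty" for z
    unfolding luxemburg_norm_def
  proof (rule cInf_eq)
    fix c assume "c \<in> {c. 0 < c \<and> orlicz_modular E N \<phi> (\<lambda>k. P z k / c) \<le> 1}"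
    then show "l_infty_norm z \<le> c"
      unfolding l_infty_norm_def using lower by (intro cSUP_least) auto
  next
    fix b assume b: "\<And>c. c \<in> {c. 0 < c \<and> orlicz_modular E N \<phi> (\<lambda>k. P z k / c) \<le> 1} \<Longrightarrow> b \<le> c"
    have "0 \<le> l_infty_norm z" using z_le[OF z, of 0] by linarith
    then have "b \<le> l_infty_norm z + e" if "0 < e" for e
      using that upper[OF z, of "l_infty_norm z + e"] by (intro b) auto
    then show "b \<le> l_infty_norm z" by (rule field_le_epsilon)
  qed
  have mem: "P z \<in> orlicz_space E N \<phi>" if z: "z \<in> l_infty" for z
  proof -
    define c where "c = l_infty_norm z + 1"
    have "0 \<le> l_infty_norm z" using z_le[OF z, of 0] by linarith
    then have c: "0 < c" "l_infty_norm z \<le> c" by (auto simp: c_def)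
    have "orlicz_modular E N \<phi> (\<lambda>k. 1 / c * P z k) < \<infinity>"
      using upper[OF z c] by (auto intro: order_le_less_trans)
    then show ?thesis unfolding orlicz_space_def using c by (auto intro!: exI[of _ "1 / c"])
  qed
  show ?thesis
    unfolding contains_order_isometric_l_infty_def
    by (rule exI[of _ P]) (auto simp: mem norm P_def fun_eq_iff algebra_simps abs_mult x0)
qed

end

lemma consecutive_blocks:
  assumes "\<And>m p. \<exists>q\<ge>p. R m (I \<inter> {p..<q})"
  obtains B :: "nat \<Rightarrow> nat set"
    where "disjoint_family B" "\<And>m. finite (B m)" "\<And>m. R m (B m)"
proof -
  define Q where "Q m p = (SOME q. p \<le> q \<and> R m (I \<inter> {p..<q}))" for m p
  have Q: "p \<le> Q m p" "R m (I \<inter> {p..<Q m p})" for m p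
    using someI_ex[OF assms[of p m]] by (simp_all add: Q_def)
  define s where "s = rec_nat 0 Q"
  have s: "s (Suc m) = Q m (s m)" for m by (simp add: s_def)
  have mono: "s m \<le> s n" if "m \<le> n" for m n
    using that by (rule lift_Suc_mono_le[of s, rotated]) (simp add: s Q)
  have "{s m..<s (Suc m)} \<inter> {s n..<s (Suc n)} = {}" if "m \<noteq> n" for m n
    using mono[of "Suc m" n] mono[of "Suc n" m] that by (cases m n rule: linorder_cases) auto
  then have "disjoint_family (\<lambda>m. {s m..<s (Suc m)})" by (auto simp: disjoint_family_on_def)
  then have "disjoint_family (\<lambda>m. I \<inter> {s m..<s (Suc m)})"
    by (rule disjoint_family_subset) auto
  then show thesis using Q s by (intro that[of "\<lambda>m. I \<inter> {s m..<s (Suc m)}"]) auto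
qed

section \<open>Orlicz functions\<close>

lemma phi_pos_above_a_val: "0 \<le> u \<Longrightarrow> a_val \<phi> < ereal u \<Longrightarrow> 0 < \<phi> u"
proof (rule ccontr)
  assume "0 \<le> u" and less: "a_val \<phi> < ereal u" and "\<not> 0 < \<phi> u"
  then have "ereal u \<le> a_val \<phi>" unfolding a_val_def by (intro Sup_upper) auto
  with less show False by simp
qed

text \<open>
  By monotonicity \<open>\<phi>\<close> vanishes below \<open>a\<^sub>\<phi>\<close>, and \<open>0 < a\<^sub>\<phi> < b\<^sub>\<phi>\<close> makes \<open>a\<^sub>\<phi>\<close> a point of continuity.
\<close>

lemma phi_zero_at_a_val:
  assumes orl: "orlicz_function \<phi>" and a: "a_val \<phi> = ereal a" "0 < a" "a_val \<phi> < b_val \<phi>"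
  shows "\<phi> a = 0"
proof -
  have mono: "mono_on {0..} \<phi>" and cont: "continuous_on {u. 0 < u \<and> ereal u < b_val \<phi>} \<phi>"
    using orl unfolding orlicz_function_def by auto
  have zero: "\<phi> u = 0" if u: "0 \<le> u" "u < a" for u
  proof -
    have "ereal u < Sup {ereal u | u. 0 \<le> u \<and> \<phi> u = 0}" using u a by (simp add: a_val_def)
    then obtain v where "u < v" "\<phi> v = 0" by (auto simp: less_Sup_iff)
    then show ?thesis using mono_onD[OF mono, of u v] u by auto
  qed
  define w where "w n = a - a / real (n + 2)" for n
  have w: "0 < w n" "w n < a" for n using a(2) by (auto simp: w_def field_simps add_pos_nonneg)
  have "w \<longlonglongrightarrow> a - 0"
    unfolding w_def
    by (intro tendsto_diff tendsto_const LIMSEQ_ignore_initial_segment[OF lim_const_over_n])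
  then have "w \<longlonglongrightarrow> a" by simp
  moreover have "\<forall>\<^sub>F n in sequentially. w n \<in> {u. 0 < u \<and> ereal u < b_val \<phi>}"
    using w a by (auto intro!: always_eventually intro: less_trans[of _ "ereal a"])
  ultimately have "(\<lambda>n. \<phi> (w n)) \<longlonglongrightarrow> \<phi> a"
    using a by (intro continuous_on_tendsto_compose[OF cont]) auto
  moreover have "\<phi> (w n) = 0" for n using w[of n] by (intro zero) auto
  ultimately show ?thesis by (simp add: LIMSEQ_const_iff)
qed

text \<open>
  A bound \<open>\<phi>(c u) \<le> K \<phi>(u)\<close> near 0 iterates to \<open>\<phi>(c\<^sup>n u) \<le> K\<^sup>n \<phi>(u)\<close> on the smaller interval
  \<open>[0, u\<^sub>0 / c\<^sup>n]\<close>. As soon as \<open>c\<^sup>n \<ge> 2\<close> this contains \<open>\<Delta>\<^sub>2(0)\<close>.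
\<close>

lemma not_delta2_zero_dilation:
  assumes nd: "\<not> delta2_zero \<phi>" and mono: "mono_on {0..} \<phi>"
    and pos: "\<And>u. 0 < u \<Longrightarrow> 0 < \<phi> u"
    and "1 < c" "0 < K" "0 < u0"
  shows "\<exists>u. 0 \<le> u \<and> u \<le> u0 \<and> ennreal K * \<phi> u < \<phi> (c * u)"
proof (rule ccontr)
  assume "\<not> ?thesis"
  then have le: "\<phi> (c * u) \<le> ennreal K * \<phi> u" if "0 \<le> u" "u \<le> u0" for u
    using that by (meson not_less)
  have iter: "\<phi> (c ^ n * u) \<le> ennreal (K ^ n) * \<phi> u" if "0 \<le> u" "c ^ n * u \<le> u0" for n u
    using that
  proof (induction n)
    case (Suc n)
    have "c ^ n * u \<le> c ^ Suc n * u"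
      using \<open>1 < c\<close> Suc.prems by (intro mult_right_mono power_increasing) auto
    then have b: "c ^ n * u \<le> u0" using Suc.prems(2) by (rule order_trans)
    have b0: "0 \<le> c ^ n * u" using Suc.prems(1) \<open>1 < c\<close> by simp
    have "\<phi> (c ^ Suc n * u) \<le> ennreal K * \<phi> (c ^ n * u)" using le[OF b0 b] by (simp add: mult.assoc)
    also have "\<dots> \<le> ennreal K * (ennreal (K ^ n) * \<phi> u)"
      using Suc.IH Suc.prems b by (intro mult_left_mono) auto
    also have "\<dots> = ennreal (K ^ Suc n) * \<phi> u" using \<open>0 < K\<close> by (simp add: ennreal_mult mult.assoc)
    finally show ?case .
  qed simp
  obtain n where n: "2 < c ^ n" using real_arch_pow[OF \<open>1 < c\<close>] by blast
  have cn: "0 < c ^ n" using \<open>1 < c\<close> by simp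
  have "\<phi> (2 * u) \<le> ennreal (K ^ n) * \<phi> u" if u: "0 \<le> u" "u \<le> u0 / c ^ n" for u
  proof -
    have "2 * u \<le> c ^ n * u" using n u by (intro mult_right_mono) auto
    then have "\<phi> (2 * u) \<le> \<phi> (c ^ n * u)" using u cn by (intro mono_onD[OF mono]) auto
    also have "\<dots> \<le> ennreal (K ^ n) * \<phi> u" using u cn by (intro iter) (auto simp: field_simps)
    finally show ?thesis .
  qed
  then have "delta2_zero \<phi>" unfolding delta2_zero_def
    using \<open>0 < K\<close> \<open>0 < u0\<close> cn pos by (intro exI[of _ "K ^ n"] exI[of _ "u0 / c ^ n"]) auto
  with nd show False by simp
qed

lemma phi_small_near_zero:
  assumes orl: "orlicz_function \<phi>" and "0 < e"
  shows "\<exists>u0>0. \<forall>u. 0 \<le> u \<and> u \<le> u0 \<longrightarrow> \<phi> u < ennreal e"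
proof -
  have "(\<phi> \<longlongrightarrow> 0) (at 0 within {0..})"
    using orl unfolding orlicz_function_def continuous_within by metis
  then have "\<forall>\<^sub>F u in at 0 within {0..}. \<phi> u < ennreal e"
    using \<open>0 < e\<close> by (intro order_tendstoD) auto
  then obtain r where r: "0 < r" "\<And>u. 0 \<le> u \<Longrightarrow> u \<noteq> 0 \<Longrightarrow> u < r \<Longrightarrow> \<phi> u < ennreal e"
    by (auto simp: eventually_at dist_real_def)
  have "\<phi> 0 < ennreal e" using orl \<open>0 < e\<close> by (simp add: orlicz_function_def)
  then have "\<phi> u < ennreal e" if "0 \<le> u" "u \<le> r / 2" for u
    using r that by (cases "u = 0") auto
  then show ?thesis using r(1) by (intro exI[of _ "r / 2"]) auto
qed

section \<open>The two cases\<close>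

context fatou_ideal_space
begin

proposition l_infty_copy_if_a_val_pos:
  assumes no_linf: "\<not> l_infty \<subseteq> E" and orl: "orlicz_function \<phi>"
    and ab: "a_val \<phi> < b_val \<phi>" and apos: "0 < a_val \<phi>"
  shows "contains_order_isometric_l_infty (orlicz_space E N \<phi>) (luxemburg_norm E N \<phi>)"
proof -
  obtain a where a: "a_val \<phi> = ereal a" "0 < a" using ab apos by (cases "a_val \<phi>") auto
  have one: "(indicator UNIV :: nat \<Rightarrow> real) \<notin> E"
  proof
    assume in_E: "(indicator UNIV :: nat \<Rightarrow> real) \<in> E"
    have "z \<in> E" if "z \<in> l_infty" for z
    proof -
      obtain b where "\<forall>r\<in>range z. norm r \<le> b" using \<open>z \<in> l_infty\<close> by (auto simp: l_infty_def bounded_iff)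
      then have "\<bar>z k\<bar> \<le> \<bar>b * indicator UNIV k\<bar>" for k
        using abs_ge_self[of b] by (auto intro: order_trans)
      then show ?thesis by (rule ideal_mem[OF scale_mem[OF in_E]])
    qed
    with no_linf show False by blast
  qed
  obtain B :: "nat \<Rightarrow> nat set" where B: "disjoint_family B" "\<And>m. finite (B m)"
    "\<And>m. real m < N (indicator (B m))"
    using consecutive_blocks[where I = UNIV and R = "\<lambda>m B. real m < N (indicator B)"]
      indicator_tail_unbounded[OF one] by blast
  have phia: "\<phi> a = 0" by (rule phi_zero_at_a_val[OF orl a ab])
  show ?thesis
  proof (rule block_criterion[where x = "\<lambda>_. a" and u = "\<lambda>_. a"])
    show "orlicz_modular E N \<phi> (\<lambda>_. a) \<le> 1"
      using a by (simp add: orlicz_modular_def phia zero_mem N_zero)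
    fix c :: real assume "1 < c"
    then have "0 < \<phi> (c * a)" using a by (intro phi_pos_above_a_val) auto
    then obtain e where e: "0 < e" "ennreal e \<le> \<phi> (c * a)"
      by (cases "\<phi> (c * a)") (auto intro: that[of 1])
    obtain j where j: "1 / e < real j" using reals_Archimedean2 by blast
    show "\<forall>\<^sub>F m in sequentially. 1 < \<phi> (c * a) * ennreal (N (indicator (B m)))"
      using eventually_ge_at_top[of j]
    proof eventually_elim
      case (elim m)
      have "1 / e < N (indicator (B m))" using j elim B(3)[of m] by linarith
      then have "1 < e * N (indicator (B m))" using e by (simp add: field_simps)
      then have "1 < ennreal e * ennreal (N (indicator (B m)))"
        using e by (simp add: ennreal_mult'[symmetric])
      also have "\<dots> \<le> \<phi> (c * a) * ennreal (N (indicator (B m)))" using e by (intro mult_right_mono) auto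
      finally show ?case .
    qed
  qed (use orl a B in \<open>auto simp: orlicz_function_def\<close>)
qed

proposition l_infty_copy_if_not_delta2:
  assumes orl: "orlicz_function \<phi>" and a0: "a_val \<phi> = 0"
    and unit: "\<And>k. k \<in> I \<Longrightarrow> N (unit_seq k) \<le> d" and "0 < d"
    and notin: "(indicator I :: nat \<Rightarrow> real) \<notin> E"
    and nd: "\<not> delta2_zero \<phi>"
  shows "contains_order_isometric_l_infty (orlicz_space E N \<phi>) (luxemburg_norm E N \<phi>)"
proof -
  have mono: "mono_on {0..} \<phi>" and phi0: "\<phi> 0 = 0" using orl by (auto simp: orlicz_function_def)
  have pos: "0 < \<phi> u" if "0 < u" for u using that a0 by (intro phi_pos_above_a_val) auto
  have C0: "0 < C" using C_ge_1 by simp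
  \<comment> \<open>\<open>e m\<close> bounds the norm of \<open>\<phi>(x)\<close> on the \<open>m\<close>-th block. The growth factor \<open>2C / e m\<close>
    compensates for the smallness of \<open>e m\<close>, and \<open>\<phi> v < e m / (2 C d)\<close> makes the target \<open>t m\<close>
    below at least \<open>d\<close>.\<close>
  define e where "e m = (1 / (2 * C)) ^ Suc m" for m
  have e0: "0 < e m" for m using C0 by (simp add: e_def)
  have "\<exists>v. 0 < v \<and> \<phi> v < ennreal (e m / (2 * C * d)) \<and>
      ennreal (2 * C / e m) * \<phi> v < \<phi> ((1 + 1 / real (Suc m)) * v)" for m
  proof -
    obtain u0 where u0: "0 < u0" "\<And>u. 0 \<le> u \<Longrightarrow> u \<le> u0 \<Longrightarrow> \<phi> u < ennreal (e m / (2 * C * d))"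
      using phi_small_near_zero[OF orl, of "e m / (2 * C * d)"] e0[of m] C0 \<open>0 < d\<close> by auto
    obtain v where "0 \<le> v" "v \<le> u0" "ennreal (2 * C / e m) * \<phi> v < \<phi> ((1 + 1 / real (Suc m)) * v)"
      using not_delta2_zero_dilation[OF nd mono pos, of "1 + 1 / real (Suc m)" "2 * C / e m" u0]
        e0[of m] C0 u0(1) by auto
    moreover have "v \<noteq> 0" using calculation phi0 by auto
    ultimately show ?thesis using u0 by (intro exI[of _ v]) auto
  qed
  then obtain u where u: "\<And>m. 0 < u m" "\<And>m. \<phi> (u m) < ennreal (e m / (2 * C * d))"
    "\<And>m. ennreal (2 * C / e m) * \<phi> (u m) < \<phi> ((1 + 1 / real (Suc m)) * u m)" by metis
  define r where "r m = enn2real (\<phi> (u m))" for m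
  have phiu: "\<phi> (u m) = ennreal (r m)" for m
    unfolding r_def using u(2)[of m] by (metis ennreal_enn2real ennreal_less_top less_trans)
  have r0: "0 < r m" for m using pos[OF u(1), of m] by (simp add: phiu)
  have r_small: "r m < e m / (2 * C * d)" for m
    using u(2)[of m] r0[of m] by (simp add: phiu ennreal_less_iff)
  \<comment> \<open>The largest target for which the upper bound \<open>r m * C * (t m + d) \<le> r m * 2 C t m\<close> on the
    norm of the \<open>m\<close>-th piece of \<open>\<phi>(x)\<close> does not exceed \<open>e m\<close>.\<close>
  define t where "t m = e m / (2 * C * r m)" for m
  have td: "d \<le> t m" for m
    using r_small[of m] r0[of m] C0 \<open>0 < d\<close> by (simp add: t_def field_simps)
  define R where "R m B \<longleftrightarrow> t m < N (indicator B) \<and> N (indicator B) \<le> C * (t m + d)" for m B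
  have "\<exists>q\<ge>p. R m (I \<inter> {p..<q})" for m p
    unfolding R_def
    by (rule indicator_tail_between[OF notin unit]) (use td[of m] \<open>0 < d\<close> in auto)
  then obtain B where B: "disjoint_family B" "\<And>m. finite (B m)" "\<And>m. R m (B m)"
    using consecutive_blocks[where R = R and I = I] by metis
  from B(3) have t_less: "t m < N (indicator (B m))" and le_t: "N (indicator (B m)) \<le> C * (t m + d)" for m
    by (auto simp: R_def)
  define x where "x k = (if \<exists>m. k \<in> B m then u (SOME m. k \<in> B m) else 0)" for k
  have xB: "x k = u m" if "k \<in> B m" for k m
  proof -
    have "k \<in> B (SOME m. k \<in> B m)" using that by (rule someI)
    with that B(1) have "(SOME m. k \<in> B m) = m" unfolding disjoint_family_on_def by blast
    with that show ?thesis by (auto simp: x_def)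
  qed
  define s where "s k = enn2real (\<phi> \<bar>x k\<bar>)" for k
  have fin: "\<phi> \<bar>x k\<bar> < \<infinity>" for k
    using u(1) by (auto simp: x_def phiu phi0 less_imp_le)
  have sums: "(\<lambda>m. r m * indicator (B m) k) sums s k" for k
  proof (cases "\<exists>m. k \<in> B m")
    case True
    then obtain m where m: "k \<in> B m" by blast
    have other: "k \<notin> B n" if "n \<noteq> m" for n using m that B(1) unfolding disjoint_family_on_def by blast
    have "s k = r m" using u(1)[of m] by (simp add: s_def xB[OF m] r_def)
    then have "(\<lambda>n. r n * indicator (B n) k) = (\<lambda>n. if n = m then s k else 0)"
      using m other by (auto simp: fun_eq_iff)
    then show ?thesis using sums_single[of m "\<lambda>_. s k"] by simp
  next
    case False
    then show ?thesis by (simp add: s_def x_def phi0)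
  qed
  have ind: "indicator (B m) \<in> E" for m using B(2) by (rule indicator_finite_mem)
  have small: "N (\<lambda>k. r m * indicator (B m) k) \<le> (1 / (2 * C)) ^ Suc m" for m
  proof -
    have "N (indicator (B m)) \<le> C * (t m + t m)"
      by (rule order_trans[OF le_t]) (use td[of m] C0 in auto)
    then have "r m * N (indicator (B m)) \<le> r m * (C * (t m + t m))"
      using r0[of m] by (intro mult_left_mono) auto
    also have "\<dots> = e m" using r0[of m] C0 by (simp add: t_def field_simps)
    finally show ?thesis using r0[of m] by (simp add: N_scale[OF ind] e_def)
  qed
  have s: "s \<in> E" "N s \<le> 1"
    by (rule rapidly_decreasing_sum[OF scale_mem[OF ind] _ small sums];
        use r0 in \<open>auto simp: less_imp_le\<close>)+
  show ?thesis
  proof (rule block_criterion[where x = x and u = u, OF mono phi0 _ _ B(1,2) xB])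
    show "0 \<le> x k" for k using u(1) by (auto simp: x_def less_imp_le)
    show "0 \<le> u m" for m using u(1) by (simp add: less_imp_le)
    show "orlicz_modular E N \<phi> x \<le> 1"
      using fin s by (simp add: orlicz_modular_def s_def[abs_def])
    fix c :: real assume "1 < c"
    then obtain j where j: "1 / (c - 1) < real j" using reals_Archimedean2 by blast
    show "\<forall>\<^sub>F m in sequentially. 1 < \<phi> (c * u m) * ennreal (N (indicator (B m)))"
      using eventually_ge_at_top[of j]
    proof eventually_elim
      case (elim m)
      \<comment> \<open>From here on the dilation factor used to choose \<open>u m\<close> is at most \<open>c\<close>.\<close>
      have "1 / (c - 1) < real (Suc m)" using j elim by linarith
      then have c: "1 + 1 / real (Suc m) \<le> c" using \<open>1 < c\<close> by (simp add: field_simps)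
      have "ennreal (2 * C / e m * r m) \<le> \<phi> ((1 + 1 / real (Suc m)) * u m)"
        using u(3)[of m] r0[of m] e0[of m] C0 by (simp add: phiu ennreal_mult[symmetric])
      also have "\<dots> \<le> \<phi> (c * u m)"
        using u(1)[of m] c \<open>1 < c\<close> by (intro mono_onD[OF mono] mult_right_mono) auto
      finally have le: "ennreal (2 * C / e m * r m) \<le> \<phi> (c * u m)" .
      have "2 * C / e m * r m * t m = 1" using r0[of m] C0 e0[of m] by (simp add: t_def)
      moreover have "2 * C / e m * r m * t m < 2 * C / e m * r m * N (indicator (B m))"
        using t_less[of m] r0[of m] C0 e0[of m] by (intro mult_strict_left_mono) auto
      ultimately have "1 < 2 * C / e m * r m * N (indicator (B m))" by (simp only:)
      then have "1 < ennreal (2 * C / e m * r m * N (indicator (B m)))" by simp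
      also have "\<dots> = ennreal (2 * C / e m * r m) * ennreal (N (indicator (B m)))"
        using r0[of m] C0 e0[of m] N_nonneg[OF ind] by (intro ennreal_mult) auto
      also have "\<dots> \<le> \<phi> (c * u m) * ennreal (N (indicator (B m)))"
        using le by (intro mult_right_mono) auto
      finally show ?case .
    qed
  qed
qed

end

theorem theorem5p9:
  fixes E :: "(nat \<Rightarrow> real) set"
    and N :: "(nat \<Rightarrow> real) \<Rightarrow> real"
    and \<phi> :: "real \<Rightarrow> ennreal"
  assumes "quasi_banach_ideal_space E N"
    and "fatou_property E N"
    and "\<not> l_infty \<subseteq> E"
    and "orlicz_function \<phi>"
    and "a_val \<phi> < b_val \<phi>"
    and "alpha_index E \<phi> > 0"
  shows "(a_val \<phi> > 0 \<longrightarrow>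
            contains_order_isometric_l_infty (orlicz_space E N \<phi>) (luxemburg_norm E N \<phi>)) \<and>
         (a_val \<phi> = 0 \<and>
          (\<exists>(d :: real) (i :: nat \<Rightarrow> nat). d > 0 \<and> strict_mono i \<and>
             (\<forall>j. unit_seq (i j) \<in> E \<and> N (unit_seq (i j)) \<le> d) \<and>
             (indicator (range i) :: nat \<Rightarrow> real) \<notin> E) \<and>
          \<not> delta2_zero \<phi> \<longrightarrow>
            contains_order_isometric_l_infty (orlicz_space E N \<phi>) (luxemburg_norm E N \<phi>))"
proof -
  obtain C where "1 \<le> C" "\<forall>x\<in>E. \<forall>y\<in>E. N (\<lambda>k. x k + y k) \<le> C * (N x + N y)"
    using assms(1) unfolding quasi_banach_ideal_space_def quasi_norm_on_def by blast
  then interpret fatou_ideal_space E N C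
    using assms(1,2) by unfold_locales auto
  show ?thesis
    using l_infty_copy_if_a_val_pos[OF assms(3-5)] l_infty_copy_if_not_delta2[OF assms(4)]
    by (blast elim: rangeE)
qed

end
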